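(* Consider the first-order multiagent system $\dot x=-Lx+Bu$, $y=Hx$ on a directed weighted graph with $n$ nodes, leader set $\mathcal{V}_L$ and target set $\mathcal{V}_T$ with $p$ elements, and suppose the pair $(-L,B)$ is not completely controllable. Let $\hat x=Px$ be a controllability decomposition with controllable part of dimension $\kappa$, write $P^{-1}=[\mathcal{P}_1,\mathcal{P}_2]$ with $\mathcal{P}_1\in\mathbb{R}^{n\times\kappa}$ and $\mathcal{P}_2\in\mathbb{R}^{n\times(n-\kappa)}$. Then the system is target controllable if and only if the target nodes are chosen from the labels $\gamma_1,\dots,\gamma_\kappa$ of a maximal linearly independent group of rows of $\mathcal{P}_1$, i.e. if and only if there exist indices $\gamma_1,\dots,\gamma_\kappa$ such that the $\gamma_1$-th, $\dots$, $\gamma_\kappa$-th rows of $\mathcal{P}_1$ form a maximal linearly independent set of rows of $\mathcal{P}_1$ and all labels of target nodes lie in $\{\gamma_1,\dots,\gamma_\kappa\}$.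
   Context: Graph: $\mathcal{G}$ is a simple directed weighted graph (no self-loops, no multiple edges) with nodes $v_1,\dots,v_n$; $a_{ij}=w_{ij}$ is the weight of the edge from $v_j$ to $v_i$ if it exists ($i\neq j$), and $a_{ij}=0$ otherwise. The Laplacian $L=[l_{ij}]$ has $l_{ii}=\sum_{k\neq i}a_{ik}$ and $l_{ij}=-a_{ij}$ for $i\ne j$. System: leader set $\mathcal{V}_L=\{v_1,\dots,v_l\}$, target set $\mathcal{V}_T=\{\bar v_1,\dots,\bar v_p\}\subseteq\mathcal{V}$; $B=[e_{v_1},\dots,e_{v_l}]\in\mathbb{R}^{n\times l}$, $H=[e_{\bar v_1},\dots,e_{\bar v_p}]^T\in\mathbb{R}^{p\times n}$, with $e_i$ the standard basis vector indexed by the node. The system is target controllable if for any initial state $x(t_0)\in\mathbb{R}^n$ and any $y_f\in\mathbb{R}^p$ there is a control input $u$ with $y(t_f)=y_f$ ($t_0<t_f$ finite); equivalently $[HB,H(-L)B,\dots,H(-L)^{n-1}B]$ has rank $p$. Controllability decomposition: $P$ is a nonsingular matrix such that $$P(-L)P^{-1}=\begin{bmatrix}\hat L_c&\hat L_{12}\\0&\hat L_{\bar c}\end{bmatrix},\qquad PB=\begin{bmatrix}\hat B_c\\0\end{bmatrix},$$ with $\hat L_c\in\mathbb{R}^{\kappa\times\kappa}$ and the pair $(\hat L_c,\hat B_c)$ controllable (so $\kappa=\operatorname{rank}[B,(-L)B,\dots,(-L)^{n-1}B]<n$). *)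

theory Defs
  imports "HOL-Analysis.Analysis"
begin

section \<open>Weighted digraphs and their Laplacians\<close>

text \<open>
  The nodes are the elements of the finite type \<^typ>\<open>'n\<close>. A pair (u, v) in E is an edge
  from u to v, and w (u, v) is its weight. Hence the entry (i, j) of the adjacency matrix
  belongs to the edge from j to i. Since E is a set of pairs, there are no multiple edges;
  absence of self-loops is the condition \<^term>\<open>irrefl E\<close>.
\<close>

definition adjacency :: "('n \<times> 'n) set \<Rightarrow> ('n \<times> 'n \<Rightarrow> real) \<Rightarrow> real^'n^'n" where
  "adjacency E w = (\<chi> i j. if (j, i) \<in> E then w (j, i) else 0)"

definition laplacian :: "('n::finite \<times> 'n) set \<Rightarrow> ('n \<times> 'n \<Rightarrow> real) \<Rightarrow> real^'n^'n" where
  "laplacian E w = (\<chi> i j. if i = j then (\<Sum>k\<in>UNIV - {i}. adjacency E w $ i $ k)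
                           else - adjacency E w $ i $ j)"

text \<open>
  Enumerations of the leaders and of the targets give the matrix B, whose columns are the
  standard basis vectors of the leaders, and the matrix H, whose rows are those of the targets.
\<close>

definition leader_matrix :: "('l \<Rightarrow> 'n) \<Rightarrow> real^'l^'n" where
  "leader_matrix vl = transpose (\<chi> j. axis (vl j) 1)"

definition target_matrix :: "('p \<Rightarrow> 'n) \<Rightarrow> real^'n^'p" where
  "target_matrix vt = (\<chi> i. axis (vt i) 1)"

section \<open>Controllability of linear systems\<close>

definition piecewise_continuous :: "(real \<Rightarrow> 'a::topological_space) \<Rightarrow> real \<Rightarrow> real \<Rightarrow> bool" where
  "piecewise_continuous u a b \<longleftrightarrow>
     (\<exists>S. finite S \<and> continuous_on ({a..b} - S) u \<and>
          (\<forall>t\<in>S \<inter> {a..<b}. \<exists>l. (u \<longlongrightarrow> l) (at_right t)) \<and>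
          (\<forall>t\<in>S \<inter> {a<..b}. \<exists>l. (u \<longlongrightarrow> l) (at_left t)))"

text \<open>
  The state x is a trajectory of x' = A x + B u on the interval from a to b. As u may jump,
  x is only required to be continuous and to satisfy the equation off a finite set.
\<close>

definition state_trajectory ::
    "real^'n^'n \<Rightarrow> real^'l^'n \<Rightarrow> (real \<Rightarrow> real^'l) \<Rightarrow> real \<Rightarrow> real \<Rightarrow> (real \<Rightarrow> real^'n) \<Rightarrow> bool" where
  "state_trajectory A B u a b x \<longleftrightarrow>
     continuous_on {a..b} x \<and>
     (\<exists>S. finite S \<and>
        (\<forall>t\<in>{a..b} - S. (x has_vector_derivative (A *v x t + B *v u t)) (at t within {a..b})))"

definition target_controllable :: "real^'n^'n \<Rightarrow> real^'l^'n \<Rightarrow> real^'n^'p \<Rightarrow> bool" where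
  "target_controllable A B H \<longleftrightarrow>
     (\<forall>t0 x0 yf. \<exists>tf>t0. \<exists>u x. piecewise_continuous u t0 tf \<and> state_trajectory A B u t0 tf x \<and>
        x t0 = x0 \<and> H *v x tf = yf)"

definition controllable :: "real^'n^'n \<Rightarrow> real^'l^'n \<Rightarrow> bool" where
  "controllable A B \<longleftrightarrow>
     (\<forall>t0 x0 xf. \<exists>tf>t0. \<exists>u x. piecewise_continuous u t0 tf \<and> state_trajectory A B u t0 tf x \<and>
        x t0 = x0 \<and> x tf = xf)"

section \<open>Controllability decomposition\<close>

text \<open>
  Block matrices are indexed by the sum type \<^typ>\<open>'k + 'c\<close>, where \<^term>\<open>CARD('k)\<close> is
  the dimension of the controllable part and \<^term>\<open>CARD('c)\<close> that of the uncontrollable part.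
\<close>

definition block_mat ::
    "real^'k^'k \<Rightarrow> real^'c^'k \<Rightarrow> real^'k^'c \<Rightarrow> real^'c^'c \<Rightarrow> real^('k::finite + 'c::finite)^('k + 'c)" where
  "block_mat M11 M12 M21 M22 =
     (\<chi> i j. case i of
        Inl a \<Rightarrow> (case j of Inl b \<Rightarrow> M11 $ a $ b | Inr b \<Rightarrow> M12 $ a $ b)
      | Inr a \<Rightarrow> (case j of Inl b \<Rightarrow> M21 $ a $ b | Inr b \<Rightarrow> M22 $ a $ b))"

definition block_col :: "real^'l^'k \<Rightarrow> real^'l^'c \<Rightarrow> real^'l^('k::finite + 'c::finite)" where
  "block_col M1 M2 = (\<chi> i j. case i of Inl a \<Rightarrow> M1 $ a $ j | Inr a \<Rightarrow> M2 $ a $ j)"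

text \<open>
  The library predicate \<^const>\<open>invertible\<close> asks for a two-sided inverse. For the matrix P
  below it therefore forces the index types \<^typ>\<open>'n\<close> and \<^typ>\<open>'k + 'c\<close> to have the same
  cardinality.
\<close>

definition controllability_decomposition ::
    "real^'n^'n \<Rightarrow> real^'l^'n \<Rightarrow> real^'n^('k::finite + 'c::finite) \<Rightarrow>
     real^'k^'k \<Rightarrow> real^'c^'k \<Rightarrow> real^'c^'c \<Rightarrow> real^'l^'k \<Rightarrow> bool" where
  "controllability_decomposition A B P Ac A12 Ad Bc \<longleftrightarrow>
     invertible P \<and>
     P ** A ** matrix_inv P = block_mat Ac A12 0 Ad \<and>
     P ** B = block_col Bc 0 \<and>
     controllable Ac Bc"

definition left_block :: "real^('k::finite + 'c::finite)^'n \<Rightarrow> real^'k^'n" where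
  "left_block M = (\<chi> i j. M $ i $ Inl j)"

section \<open>Maximal linearly independent groups of rows\<close>

text \<open>
  The rows with labels in I are independent as a family: equal rows with different labels
  count as dependent, whence the injectivity condition.
\<close>

definition independent_rows :: "real^'k^'n \<Rightarrow> 'n set \<Rightarrow> bool" where
  "independent_rows M I \<longleftrightarrow> inj_on (\<lambda>i. row i M) I \<and> independent ((\<lambda>i. row i M) ` I)"

definition maximal_independent_rows :: "real^'k^'n \<Rightarrow> 'n set \<Rightarrow> bool" where
  "maximal_independent_rows M I \<longleftrightarrow>
     independent_rows M I \<and> (\<forall>J. I \<subset> J \<longrightarrow> \<not> independent_rows M J)"

end

theory Submission
  imports Defs
begin

text \<open>
  Let \<open>P1\<close> be the left block of the inverse of \<open>P\<close>. The uncontrollable component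
  of a trajectory that starts at the origin solves a homogeneous linear equation and so vanishes;
  hence the outputs reachable from the origin lie in the range of \<open>H P1\<close>. Conversely, \<open>P1\<close> maps
  trajectories of the controllable part to trajectories of the whole system, and these can be
  superposed on the free motion. Thus target controllability means that \<open>H P1\<close> is surjective, that
  is, that the target rows of \<open>P1\<close> are independent. Since \<open>P1\<close> has a left inverse, its maximal
  independent groups of rows all have as many members as \<open>P1\<close> has columns.
\<close>

section \<open>Linear differential equations\<close>

text \<open>The solution is the matrix exponential \<open>exp ((t - t0) A)\<close> applied to
  \<open>x0\<close>. It is built component by component as a real power series, so that termwise
  differentiation of scalar series applies.\<close>

lemma linear_ode_solution:
  fixes A :: "real^'n^'n"
  obtains x where "x t0 = x0"
    and "\<And>t. (x has_vector_derivative A *v x t) (at t)"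
proof -
  define v where "v k = (((*v) A) ^^ k) x0" for k
  define K where "K = onorm ((*v) A)"
  have v_Suc: "v (Suc k) = A *v v k" for k
    by (simp add: v_def)
  have K: "norm (A *v y) \<le> K * norm y" for y
    unfolding K_def by (rule onorm) simp
  have v_bound: "norm (v k) \<le> K ^ k * norm x0" for k
  proof (induction k)
    case (Suc k)
    have "norm (v (Suc k)) \<le> K * norm (v k)"
      using K by (simp add: v_Suc)
    also have "\<dots> \<le> K * (K ^ k * norm x0)"
      using Suc by (intro mult_left_mono) (auto simp: K_def onorm_pos_le)
    finally show ?case by (simp add: mult.assoc)
  qed (simp add: v_def)
  \<comment> \<open>Taylor coefficients at 0 of component \<open>i\<close> of
    \<open>exp (s A)\<close> applied to \<open>x0\<close>, since \<open>v k\<close> is the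
    \<open>k\<close>-th iterate of \<open>A\<close> on \<open>x0\<close>.\<close>
  define c where "c i k = v k $ i / fact k" for i k
  \<comment> \<open>The majorant is the exponential series of \<open>K * |y|\<close>, scaled by
    \<open>norm x0\<close>.\<close>
  have summ: "summable (\<lambda>k. c i k * y ^ k)" for i y
  proof (rule summable_comparison_test')
    show "summable (\<lambda>k. norm x0 * (inverse (fact k) * (K * \<bar>y\<bar>) ^ k))"
      by (intro summable_mult summable_exp)
    show "norm (c i k * y ^ k) \<le> norm x0 * (inverse (fact k) * (K * \<bar>y\<bar>) ^ k)" for k
    proof -
      have "\<bar>v k $ i\<bar> \<le> K ^ k * norm x0"
        using component_le_norm_cart[of "v k" i] v_bound[of k] by linarith
      then have "\<bar>v k $ i\<bar> * (\<bar>y\<bar> ^ k / fact k) \<le> (K ^ k * norm x0) * (\<bar>y\<bar> ^ k / fact k)"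
        by (intro mult_right_mono) auto
      then show ?thesis
        by (simp add: c_def abs_mult power_abs power_mult_distrib field_simps)
    qed
  qed
  \<comment> \<open>The factor \<open>k + 1\<close> produced by differentiation cancels against
    \<open>fact (k + 1)\<close>, and the shifted index turns \<open>v k\<close> into
    \<open>A *v v k\<close>: this is the equation on the level of coefficients.\<close>
  have diffs_c: "diffs (c i) k = (\<Sum>j\<in>UNIV. A $ i $ j * c j k)" for i k
  proof -
    have "diffs (c i) k = (A *v v k) $ i / fact k"
      by (simp add: diffs_def c_def v_Suc divide_simps del: of_nat_Suc)
    then show ?thesis
      by (simp add: matrix_vector_mult_def c_def sum_divide_distrib)
  qed
  define g where "g i s = (\<Sum>k. c i k * s ^ k)" for i and s :: real
  have g: "(g i has_field_derivative (\<Sum>j\<in>UNIV. A $ i $ j * g j s)) (at s)" for i s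
  proof -
    have "(\<Sum>k. diffs (c i) k * s ^ k) = (\<Sum>k. \<Sum>j\<in>UNIV. A $ i $ j * (c j k * s ^ k))"
      by (simp add: diffs_c sum_distrib_right mult.assoc)
    also have "\<dots> = (\<Sum>j\<in>UNIV. \<Sum>k. A $ i $ j * (c j k * s ^ k))"
      by (intro suminf_sum summable_mult summ)
    also have "\<dots> = (\<Sum>j\<in>UNIV. A $ i $ j * g j s)"
      by (simp add: g_def suminf_mult summ)
    finally show ?thesis
      using termdiffs_strong_converges_everywhere[of "c i" s] summ by (simp add: g_def[abs_def])
  qed
  define x where "x t = (\<chi> i. g i (t - t0))" for t
  have x_nth: "x t $ i = g i (t - t0)" for t i
    by (simp add: x_def)
  show thesis
  proof
    have "g i 0 = x0 $ i" for i
      unfolding g_def powser_zero by (simp add: c_def v_def)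
    then show "x t0 = x0"
      by (simp add: x_nth vec_eq_iff)
    show "(x has_vector_derivative A *v x t) (at t)" for t
      unfolding has_vector_derivative_def
    proof (subst has_derivative_componentwise_within, intro ballI)
      fix e :: "real^'n" assume "e \<in> Basis"
      then obtain i where e: "e = axis i 1"
        by (auto simp: Basis_vec_def)
      have "((\<lambda>t. g i (t - t0)) has_field_derivative (A *v x t) $ i) (at t)"
        using DERIV_shift[of "g i" _ t "- t0"] g[of i "t - t0"]
        by (simp add: x_nth matrix_vector_mult_def)
      then show "((\<lambda>t. x t \<bullet> e) has_derivative (\<lambda>h. (h *\<^sub>R (A *v x t)) \<bullet> e)) (at t)"
        by (simp add: e inner_axis x_nth has_field_derivative_def mult_commute_abs)
    qed
  qed
qed

text \<open>Energy estimate: \<open>exp (-2Kt) |x t|^2\<close> is nonincreasing when \<open>K\<close> is the operator norm of \<open>A\<close>.\<close>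

lemma linear_ode_zero:
  fixes A :: "real^'n^'n"
  assumes "a \<le> b" and cont: "continuous_on {a..b} x" and "finite S" and "x a = 0"
    and deriv: "\<And>t. t \<in> {a..b} - S \<Longrightarrow> (x has_vector_derivative A *v x t) (at t within {a..b})"
  shows "x b = 0"
proof -
  define K where "K = onorm ((*v) A)"
  have K: "norm (A *v y) \<le> K * norm y" for y
    unfolding K_def by (rule onorm) simp
  define g where "g t = exp (- 2 * K * t) * (x t \<bullet> x t)" for t
  define g' where "g' t = 2 * exp (- 2 * K * t) * (x t \<bullet> (A *v x t) - K * (x t \<bullet> x t))" for t
  \<comment> \<open>The equation holds only off \<open>S\<close>, so the decrease of
    \<open>g\<close> is read off from the integral of \<open>g'\<close>, for which finitely many
    exceptional points are harmless.\<close>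
  have "(g' has_integral (g b - g a)) {a..b}"
  proof (rule fundamental_theorem_of_calculus_interior_strong[OF \<open>finite S\<close> \<open>a \<le> b\<close>])
    show "continuous_on {a..b} g"
      unfolding g_def by (intro continuous_intros cont)
    show "(g has_vector_derivative g' t) (at t)" if t: "t \<in> {a<..<b} - S" for t
    proof -
      have "(x has_vector_derivative A *v x t) (at t)"
        using deriv[of t] t at_within_Icc_at[of a t b] by auto
      then have x: "(x has_derivative (\<lambda>h. h *\<^sub>R (A *v x t))) (at t)"
        by (simp add: has_vector_derivative_def)
      show ?thesis
        unfolding g_def has_vector_derivative_def
        by (rule derivative_eq_intros x refl | simp)+
          (simp add: g'_def inner_commute algebra_simps)
    qed
  qed
  moreover have "g' t \<le> 0" for t
  proof -
    have "x t \<bullet> (A *v x t) \<le> norm (x t) * norm (A *v x t)"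
      by (rule norm_cauchy_schwarz)
    also have "\<dots> \<le> norm (x t) * (K * norm (x t))"
      by (intro mult_left_mono K) simp
    also have "\<dots> = K * (x t \<bullet> x t)"
      by (simp add: dot_square_norm power2_eq_square)
    finally show ?thesis
      by (simp add: g'_def mult_nonneg_nonpos)
  qed
  ultimately have "g b - g a \<le> 0"
    using has_integral_nonneg[OF has_integral_neg, of g' "g b - g a" "{a..b}"] by simp
  then have "g b \<le> 0"
    by (simp add: g_def \<open>x a = 0\<close>)
  then have "x b \<bullet> x b \<le> 0"
    by (simp add: g_def mult_le_0_iff not_le[symmetric])
  then show ?thesis
    by (metis inner_eq_zero_iff inner_ge_zero order_antisym)
qed

section \<open>Piecewise continuous controls\<close>

text \<open>Close enough to \<open>t\<close>, no point of the finite set \<open>S\<close> lies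
  strictly to the right of \<open>t\<close>. Hence a limit taken within the interval minus
  \<open>S\<close> yields a right limit.\<close>

lemma at_right_le_at_within_cofinite:
  fixes t :: real
  assumes "finite S" "t \<in> {a..<b}"
  shows "at_right t \<le> at t within ({a..b} - S)"
proof -
  \<comment> \<open>Sparing \<open>t\<close> itself keeps this set a neighbourhood of
    \<open>t\<close> even when \<open>t\<close> belongs to \<open>S\<close>.\<close>
  have "open ({..<b} - (S - {t}))"
    using assms by (intro open_Diff finite_imp_closed) auto
  then have "at_right t = at t within ({t<..} \<inter> ({a..b} - S))"
    by (rule at_within_nhd[rotated]) (use assms in auto)
  also have "\<dots> \<le> at t within ({a..b} - S)"
    by (intro at_le) auto
  finally show ?thesis .
qed

lemma at_left_le_at_within_cofinite:
  fixes t :: real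
  assumes "finite S" "t \<in> {a<..b}"
  shows "at_left t \<le> at t within ({a..b} - S)"
proof -
  have "open ({a<..} - (S - {t}))"
    using assms by (intro open_Diff finite_imp_closed) auto
  then have "at_left t = at t within ({..<t} \<inter> ({a..b} - S))"
    by (rule at_within_nhd[rotated]) (use assms in auto)
  also have "\<dots> \<le> at t within ({a..b} - S)"
    by (intro at_le) auto
  finally show ?thesis .
qed

text \<open>Off \<open>S\<close> the one-sided limits come from continuity. Having them at every
  point allows the exceptional sets of two controls to be merged.\<close>

lemma piecewise_continuousE:
  assumes "piecewise_continuous u a b"
  obtains S where "finite S" "continuous_on ({a..b} - S) u"
    "\<And>t. t \<in> {a..<b} \<Longrightarrow> \<exists>l. (u \<longlongrightarrow> l) (at_right t)"
    "\<And>t. t \<in> {a<..b} \<Longrightarrow> \<exists>l. (u \<longlongrightarrow> l) (at_left t)"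
proof -
  obtain S where S: "finite S" "continuous_on ({a..b} - S) u"
      "\<forall>t\<in>S \<inter> {a..<b}. \<exists>l. (u \<longlongrightarrow> l) (at_right t)"
      "\<forall>t\<in>S \<inter> {a<..b}. \<exists>l. (u \<longlongrightarrow> l) (at_left t)"
    using assms unfolding piecewise_continuous_def by blast
  have lim: "(u \<longlongrightarrow> u t) (at t within ({a..b} - S))" if "t \<in> {a..b} - S" for t
    using S(2) that by (simp add: continuous_on)
  show thesis
  proof
    show "\<exists>l. (u \<longlongrightarrow> l) (at_right t)" if "t \<in> {a..<b}" for t
      using S(3) that tendsto_mono[OF at_right_le_at_within_cofinite[OF S(1) that] lim] by fastforce
    show "\<exists>l. (u \<longlongrightarrow> l) (at_left t)" if "t \<in> {a<..b}" for t
      using S(4) that tendsto_mono[OF at_left_le_at_within_cofinite[OF S(1) that] lim] by fastforce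
  qed (use S in auto)
qed

lemma piecewise_continuous_const: "piecewise_continuous (\<lambda>t. c) a b"
  unfolding piecewise_continuous_def by (rule exI[of _ "{}"]) simp

lemma piecewise_continuous_add:
  fixes u v :: "real \<Rightarrow> 'a::topological_monoid_add"
  assumes "piecewise_continuous u a b" "piecewise_continuous v a b"
  shows "piecewise_continuous (\<lambda>t. u t + v t) a b"
proof -
  obtain S where S: "finite S" "continuous_on ({a..b} - S) u"
    "\<And>t. t \<in> {a..<b} \<Longrightarrow> \<exists>l. (u \<longlongrightarrow> l) (at_right t)"
    "\<And>t. t \<in> {a<..b} \<Longrightarrow> \<exists>l. (u \<longlongrightarrow> l) (at_left t)"
    using piecewise_continuousE[OF assms(1)] by metis
  obtain T where T: "finite T" "continuous_on ({a..b} - T) v"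
    "\<And>t. t \<in> {a..<b} \<Longrightarrow> \<exists>l. (v \<longlongrightarrow> l) (at_right t)"
    "\<And>t. t \<in> {a<..b} \<Longrightarrow> \<exists>l. (v \<longlongrightarrow> l) (at_left t)"
    using piecewise_continuousE[OF assms(2)] by metis
  have "continuous_on ({a..b} - (S \<union> T)) (\<lambda>t. u t + v t)"
    by (intro continuous_on_add continuous_on_subset[OF S(2)] continuous_on_subset[OF T(2)]) auto
  then show ?thesis
    unfolding piecewise_continuous_def
    by (intro exI[of _ "S \<union> T"]) (use S(1,3,4) T(1,3,4) in \<open>blast intro: tendsto_add\<close>)
qed

lemma piecewise_continuous_scaleR:
  fixes u :: "real \<Rightarrow> 'a::real_normed_vector"
  assumes "piecewise_continuous u a b"
  shows "piecewise_continuous (\<lambda>t. c *\<^sub>R u t) a b"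
proof -
  obtain S where S: "finite S" "continuous_on ({a..b} - S) u"
    "\<And>t. t \<in> {a..<b} \<Longrightarrow> \<exists>l. (u \<longlongrightarrow> l) (at_right t)"
    "\<And>t. t \<in> {a<..b} \<Longrightarrow> \<exists>l. (u \<longlongrightarrow> l) (at_left t)"
    using piecewise_continuousE[OF assms(1)] by metis
  have "\<exists>l. ((\<lambda>t. c *\<^sub>R u t) \<longlongrightarrow> l) F" if "\<exists>l. (u \<longlongrightarrow> l) F" for F
    using that tendsto_scaleR[OF tendsto_const] by metis
  then show ?thesis
    unfolding piecewise_continuous_def
    using S by (intro exI[of _ S] conjI continuous_intros) auto
qed

section \<open>Controls shifted in time or preceded by rest\<close>

lemma piecewise_continuous_shift:
  assumes "piecewise_continuous u a b"
  shows "piecewise_continuous (\<lambda>t. u (t - s)) (a + s) (b + s)"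
proof -
  obtain S where S: "finite S" "continuous_on ({a..b} - S) u"
    "\<And>t. t \<in> {a..<b} \<Longrightarrow> \<exists>l. (u \<longlongrightarrow> l) (at_right t)"
    "\<And>t. t \<in> {a<..b} \<Longrightarrow> \<exists>l. (u \<longlongrightarrow> l) (at_left t)"
    using piecewise_continuousE[OF assms(1)] by metis
  have R: "filterlim (\<lambda>t. t - s) (at_right (r - s)) (at_right r)" for r
    unfolding filterlim_at
    by (auto intro!: tendsto_intros simp: eventually_at intro: exI[of _ 1])
  have L: "filterlim (\<lambda>t. t - s) (at_left (r - s)) (at_left r)" for r
    unfolding filterlim_at
    by (auto intro!: tendsto_intros simp: eventually_at intro: exI[of _ 1])
  show ?thesis
    unfolding piecewise_continuous_def
  proof (intro exI[of _ "(\<lambda>t. t + s) ` S"] conjI ballI)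
    show "continuous_on ({a + s..b + s} - (\<lambda>t. t + s) ` S) (\<lambda>t. u (t - s))"
      by (rule continuous_on_compose2[OF S(2)])
        (auto intro!: continuous_intros simp: image_iff algebra_simps,
          metis diff_add_cancel add.commute)
    fix t assume "t \<in> (\<lambda>t. t + s) ` S \<inter> {a + s..<b + s}"
    then have "t - s \<in> {a..<b}" by auto
    from S(3)[OF this] show "\<exists>l. ((\<lambda>t. u (t - s)) \<longlongrightarrow> l) (at_right t)"
      using filterlim_compose[OF _ R] by blast
  next
    fix t assume "t \<in> (\<lambda>t. t + s) ` S \<inter> {a + s<..b + s}"
    then have "t - s \<in> {a<..b}" by auto
    from S(4)[OF this] show "\<exists>l. ((\<lambda>t. u (t - s)) \<longlongrightarrow> l) (at_left t)"
      using filterlim_compose[OF _ L] by blast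
  qed (use S in auto)
qed

lemma piecewise_continuous_delay:
  fixes u :: "real \<Rightarrow> 'a::real_normed_vector"
  assumes "piecewise_continuous u c b" "a \<le> c" "c < b"
  shows "piecewise_continuous (\<lambda>t. if t \<le> c then 0 else u t) a b" (is "piecewise_continuous ?v a b")
proof -
  obtain S where S: "finite S" "continuous_on ({c..b} - S) u"
    "\<And>t. t \<in> {c..<b} \<Longrightarrow> \<exists>l. (u \<longlongrightarrow> l) (at_right t)"
    "\<And>t. t \<in> {c<..b} \<Longrightarrow> \<exists>l. (u \<longlongrightarrow> l) (at_left t)"
    using piecewise_continuousE[OF assms(1)] by metis
  have zero_left: "(?v \<longlongrightarrow> 0) (at_left t)" if "t \<le> c" for t
    by (rule tendsto_eventually) (use that in \<open>auto simp: eventually_at intro!: exI[of _ 1]\<close>)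
  have zero_right: "(?v \<longlongrightarrow> 0) (at_right t)" if "t < c" for t
    by (rule tendsto_eventually)
      (use that in \<open>auto simp: eventually_at dist_real_def intro!: exI[of _ "c - t"]\<close>)
  have right: "(?v \<longlongrightarrow> l) (at_right t)" if "c \<le> t" "(u \<longlongrightarrow> l) (at_right t)" for t l
    by (rule Lim_transform_eventually[OF that(2)])
      (use that in \<open>auto simp: eventually_at intro!: exI[of _ 1]\<close>)
  have left: "(?v \<longlongrightarrow> l) (at_left t)" if "c < t" "(u \<longlongrightarrow> l) (at_left t)" for t l
    by (rule Lim_transform_eventually[OF that(2)])
      (use that in \<open>auto simp: eventually_at dist_real_def intro!: exI[of _ "t - c"]\<close>)
  \<comment> \<open>The switching time \<open>c\<close> is a possible new jump: the left limit there
    is 0, while the right limit is that of \<open>u\<close>.\<close>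
  have "continuous_on ({a..b} - insert c S) ?v"
    unfolding continuous_on_eq_continuous_within
  proof
    fix t assume t: "t \<in> {a..b} - insert c S"
    show "continuous (at t within {a..b} - insert c S) ?v"
    proof (cases "t < c")
      case True
      show ?thesis
        by (rule continuous_transform_within[where f = "\<lambda>_. 0" and \<delta> = "c - t"])
          (use t True in \<open>auto simp: dist_real_def\<close>)
    next
      case False
      have "continuous (at t within {c..b} - S) u"
        using S(2) t False by (simp add: continuous_on_eq_continuous_within)
      moreover have "at t within {a..b} - insert c S = at t within {c..b} - S"
        by (rule at_within_nhd[of _ "{c<..}"]) (use t False assms in auto)
      ultimately have "continuous (at t within {a..b} - insert c S) u"
        by simp
      then show ?thesis
        by (rule continuous_transform_within[where \<delta> = "t - c"])
          (use t False in \<open>auto simp: dist_real_def\<close>)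
    qed
  qed
  moreover have "\<exists>l. (?v \<longlongrightarrow> l) (at_right t)" if "t \<in> {a..<b}" for t
    using S(3)[of t] zero_right[of t] right[of t] that by (cases "t < c") fastforce+
  moreover have "\<exists>l. (?v \<longlongrightarrow> l) (at_left t)" if "t \<in> {a<..b}" for t
    using S(4)[of t] zero_left[of t] left[of t] that by (cases "t \<le> c") fastforce+
  ultimately show ?thesis
    unfolding piecewise_continuous_def using S(1) by (intro exI[of _ "insert c S"]) auto
qed

section \<open>Steering\<close>

text \<open>Control and trajectory are hidden, but the time interval stays explicit: transfers can
  be superposed only over a common interval.\<close>

definition steers ::
    "real^'n^'n \<Rightarrow> real^'l^'n \<Rightarrow> real \<Rightarrow> real \<Rightarrow> real^'n \<Rightarrow> real^'n \<Rightarrow> bool" where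
  "steers A B a b x0 xf \<longleftrightarrow>
     (\<exists>u x. piecewise_continuous u a b \<and> state_trajectory A B u a b x \<and> x a = x0 \<and> x b = xf)"

lemma controllable_steers:
  "controllable A B \<longleftrightarrow> (\<forall>t0 x0 xf. \<exists>tf>t0. steers A B t0 tf x0 xf)"
  unfolding controllable_def steers_def by blast

lemma target_controllable_steers:
  "target_controllable A B H \<longleftrightarrow> (\<forall>t0 x0 yf. \<exists>tf>t0. \<exists>xf. steers A B t0 tf x0 xf \<and> H *v xf = yf)"
  unfolding target_controllable_def steers_def by blast

section \<open>Superposition, scaling, time shift and delay of transfers\<close>

lemma steers_add:
  assumes "steers A B a b x0 xf" "steers A B a b y0 yf"
  shows "steers A B a b (x0 + y0) (xf + yf)"
proof -
  obtain u x S where u: "piecewise_continuous u a b" and x: "continuous_on {a..b} x"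
      "x a = x0" "x b = xf" and S: "finite S"
      "\<And>t. t \<in> {a..b} - S \<Longrightarrow> (x has_vector_derivative (A *v x t + B *v u t)) (at t within {a..b})"
    using assms(1) unfolding steers_def state_trajectory_def by metis
  obtain v y T where v: "piecewise_continuous v a b" and y: "continuous_on {a..b} y"
      "y a = y0" "y b = yf" and T: "finite T"
      "\<And>t. t \<in> {a..b} - T \<Longrightarrow> (y has_vector_derivative (A *v y t + B *v v t)) (at t within {a..b})"
    using assms(2) unfolding steers_def state_trajectory_def by metis
  have "state_trajectory A B (\<lambda>t. u t + v t) a b (\<lambda>t. x t + y t)"
    unfolding state_trajectory_def
  proof (intro conjI exI[of _ "S \<union> T"] ballI)
    fix t assume "t \<in> {a..b} - (S \<union> T)"
    then have "((\<lambda>t. x t + y t) has_vector_derivative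
        (A *v x t + B *v u t) + (A *v y t + B *v v t)) (at t within {a..b})"
      by (intro has_vector_derivative_add S T) auto
    then show "((\<lambda>t. x t + y t) has_vector_derivative
        A *v (x t + y t) + B *v (u t + v t)) (at t within {a..b})"
      by (simp add: matrix_vector_right_distrib algebra_simps)
  qed (use S T x y in \<open>auto intro: continuous_intros\<close>)
  then show ?thesis
    unfolding steers_def using piecewise_continuous_add[OF u v] x y by blast
qed

lemma steers_scaleR:
  assumes "steers A B a b x0 xf"
  shows "steers A B a b (c *\<^sub>R x0) (c *\<^sub>R xf)"
proof -
  obtain u x S where u: "piecewise_continuous u a b" and x: "continuous_on {a..b} x"
      "x a = x0" "x b = xf" and S: "finite S"
      "\<And>t. t \<in> {a..b} - S \<Longrightarrow> (x has_vector_derivative (A *v x t + B *v u t)) (at t within {a..b})"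
    using assms(1) unfolding steers_def state_trajectory_def by metis
  have "state_trajectory A B (\<lambda>t. c *\<^sub>R u t) a b (\<lambda>t. c *\<^sub>R x t)"
    unfolding state_trajectory_def
  proof (intro conjI exI[of _ S] ballI)
    fix t assume "t \<in> {a..b} - S"
    then have "((\<lambda>t. c *\<^sub>R x t) has_vector_derivative c *\<^sub>R (A *v x t + B *v u t)) (at t within {a..b})"
      by (intro bounded_linear.has_vector_derivative[OF bounded_linear_scaleR_right] S)
    then show "((\<lambda>t. c *\<^sub>R x t) has_vector_derivative
        A *v (c *\<^sub>R x t) + B *v (c *\<^sub>R u t)) (at t within {a..b})"
      by (simp add: matrix_vector_mult_scaleR scaleR_add_right)
  qed (use S x in \<open>auto intro: continuous_intros\<close>)
  then show ?thesis
    unfolding steers_def using piecewise_continuous_scaleR[OF u] x by blast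
qed

lemma steers_shift:
  assumes "steers A B a b x0 xf"
  shows "steers A B (a + s) (b + s) x0 xf"
proof -
  obtain u x S where u: "piecewise_continuous u a b" and x: "continuous_on {a..b} x"
      "x a = x0" "x b = xf" and S: "finite S"
      "\<And>t. t \<in> {a..b} - S \<Longrightarrow> (x has_vector_derivative (A *v x t + B *v u t)) (at t within {a..b})"
    using assms(1) unfolding steers_def state_trajectory_def by metis
  have img: "(\<lambda>t. t - s) ` {a + s..b + s} = {a..b}"
    using image_add_atLeastAtMost'[of "- s" "a + s" "b + s"] by simp
  have "state_trajectory A B (\<lambda>t. u (t - s)) (a + s) (b + s) (\<lambda>t. x (t - s))"
    unfolding state_trajectory_def
  proof (intro conjI exI[of _ "(\<lambda>t. t + s) ` S"] ballI)
    show "continuous_on {a + s..b + s} (\<lambda>t. x (t - s))"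
      by (rule continuous_on_compose2[OF x(1)]) (auto intro!: continuous_intros)
    fix t assume t: "t \<in> {a + s..b + s} - (\<lambda>t. t + s) ` S"
    then have "t - s \<in> {a..b} - S"
      by (auto simp: image_iff)
    then have *: "(x has_vector_derivative (A *v x (t - s) + B *v u (t - s)))
        (at (t - s) within (\<lambda>t. t - s) ` {a + s..b + s})"
      unfolding img by (rule S)
    have "((\<lambda>t. t - s) has_vector_derivative 1) (at t within {a + s..b + s})"
      by (auto intro!: derivative_eq_intros)
    from vector_diff_chain_within[OF this *]
    show "((\<lambda>t. x (t - s)) has_vector_derivative
        A *v x (t - s) + B *v u (t - s)) (at t within {a + s..b + s})"
      by (simp add: o_def)
  qed (use S in auto)
  then show ?thesis
    unfolding steers_def using piecewise_continuous_shift[OF u, of s] x by fastforce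
qed

text \<open>The origin is an equilibrium under zero input, so the system can rest there until
  \<open>c\<close> and then follow the given transfer.\<close>

lemma steers_delay:
  assumes "steers A B c b 0 xf" "a \<le> c" "c < b"
  shows "steers A B a b 0 xf"
proof -
  obtain u x S where u: "piecewise_continuous u c b" and x: "continuous_on {c..b} x"
      "x c = 0" "x b = xf" and S: "finite S"
      "\<And>t. t \<in> {c..b} - S \<Longrightarrow> (x has_vector_derivative (A *v x t + B *v u t)) (at t within {c..b})"
    using assms(1) unfolding steers_def state_trajectory_def by metis
  define v where "v t = (if t \<le> c then 0 else u t)" for t
  define y where "y t = (if t \<le> c then 0 else x t)" for t
  \<comment> \<open>The time \<open>c\<close> joins the exceptional set, because the derivative of
    \<open>y\<close> may jump when the input sets in.\<close>
  have "state_trajectory A B v a b y"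
    unfolding state_trajectory_def
  proof (intro conjI exI[of _ "insert c S"] ballI)
    have "{t \<in> {a..b}. c \<le> t} = {c..b}"
      using assms by auto
    \<comment> \<open>The two pieces agree at \<open>c\<close> because
      \<open>x c = 0\<close>.\<close>
    then show "continuous_on {a..b} y"
      unfolding y_def
      by (intro continuous_on_cases_le continuous_intros) (use x in auto)
    fix t assume t: "t \<in> {a..b} - insert c S"
    show "(y has_vector_derivative A *v y t + B *v v t) (at t within {a..b})"
    proof (cases "t < c")
      case True
      have "(y has_vector_derivative 0) (at t within {a..b})"
        by (rule has_vector_derivative_transform_within[of "\<lambda>_. 0" _ _ _ "c - t"])
          (use t True in \<open>auto simp: y_def dist_real_def\<close>)
      then show ?thesis
        using True by (simp add: y_def v_def)
    next
      case False
      have "(x has_vector_derivative (A *v x t + B *v u t)) (at t within {c..b})"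
        using S(2)[of t] t False by auto
      moreover have "at t within {a..b} = at t within {c..b}"
        by (rule at_within_nhd[of _ "{c<..}"]) (use t False assms in auto)
      ultimately have "(x has_vector_derivative (A *v x t + B *v u t)) (at t within {a..b})"
        by simp
      then have "(y has_vector_derivative (A *v x t + B *v u t)) (at t within {a..b})"
        by (rule has_vector_derivative_transform_within[where d = "t - c"])
          (use t False in \<open>auto simp: y_def dist_real_def\<close>)
      then show ?thesis
        using t False by (simp add: y_def v_def)
    qed
  qed (use S in auto)
  moreover have "piecewise_continuous v a b"
    using piecewise_continuous_delay[OF u assms(2,3)] by (simp add: v_def[abs_def])
  ultimately show ?thesis
    unfolding steers_def using x assms by (intro exI[of _ v] exI[of _ y]) (auto simp: y_def)
qed

text \<open>Zero control always gives a trajectory. Its endpoint is left open, since superposition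
  with a transfer from the origin will correct the output.\<close>

lemma steers_free:
  obtains xf where "steers A B a b x0 xf"
proof -
  obtain x where x: "x a = x0" "\<And>t. (x has_vector_derivative A *v x t) (at t)"
    using linear_ode_solution[of a x0 A] by blast
  have "state_trajectory A B (\<lambda>_. 0) a b x"
    unfolding state_trajectory_def
    using x(2) by (auto intro!: exI[of _ "{}"] continuous_at_imp_continuous_on
        intro: has_vector_derivative_continuous has_vector_derivative_at_within)
  then have "steers A B a b x0 (x b)"
    unfolding steers_def using x(1) piecewise_continuous_const by blast
  then show thesis ..
qed

text \<open>Apply \<open>Q\<close> to the differential equation and keep the control. The matrix
  \<open>Q\<close> may be rectangular: the lower block of \<open>P\<close> projects to the
  uncontrollable part, and the left block of its inverse embeds the controllable part.\<close>

lemma steers_intertwine: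
  fixes A :: "real^'n^'n" and A' :: "real^'m^'m"
  assumes "steers A B a b x0 xf" and QA: "Q ** A = A' ** Q" and QB: "Q ** B = B'"
  shows "steers A' B' a b (Q *v x0) (Q *v xf)"
proof -
  obtain u x S where u: "piecewise_continuous u a b" and x: "continuous_on {a..b} x"
      "x a = x0" "x b = xf" and S: "finite S"
      "\<And>t. t \<in> {a..b} - S \<Longrightarrow> (x has_vector_derivative (A *v x t + B *v u t)) (at t within {a..b})"
    using assms(1) unfolding steers_def state_trajectory_def by metis
  have "state_trajectory A' B' u a b (\<lambda>t. Q *v x t)"
    unfolding state_trajectory_def
  proof (intro conjI exI[of _ S] ballI)
    show "continuous_on {a..b} (\<lambda>t. Q *v x t)"
      by (intro bounded_linear.continuous_on[OF matrix_vector_mul_bounded_linear] x)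
    fix t assume "t \<in> {a..b} - S"
    then have "((\<lambda>t. Q *v x t) has_vector_derivative Q *v (A *v x t + B *v u t)) (at t within {a..b})"
      by (intro bounded_linear.has_vector_derivative[OF matrix_vector_mul_bounded_linear] S)
    then show "((\<lambda>t. Q *v x t) has_vector_derivative
        A' *v (Q *v x t) + B' *v u t) (at t within {a..b})"
      by (simp add: matrix_vector_right_distrib matrix_vector_mul_assoc QA QB)
  qed (use S in auto)
  then show ?thesis
    unfolding steers_def using u x by blast
qed

lemma steers_uncontrolled_zero:
  assumes "steers A 0 a b 0 xf" "a \<le> b"
  shows "xf = 0"
proof -
  obtain x S where "continuous_on {a..b} x" "finite S" "x a = 0" "x b = xf"
      "\<And>t. t \<in> {a..b} - S \<Longrightarrow> (x has_vector_derivative A *v x t) (at t within {a..b})"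
    using assms(1) unfolding steers_def state_trajectory_def matrix_vector_mult_0 add_0_right by metis
  then show ?thesis
    using linear_ode_zero[OF assms(2), of x S A] by blast
qed

text \<open>
  The terminal time in the definition of controllability depends on the terminal state. Since the
  system may rest at the origin first, the latest of the times for the basis vectors serves for all.
\<close>

lemma controllable_fixed_time:
  fixes A :: "real^'n^'n"
  assumes "controllable A B"
  obtains b where "b > a" "\<And>xf. steers A B a b 0 xf"
proof -
  have "\<forall>e. \<exists>t>a. steers A B a t 0 e"
    using assms by (simp add: controllable_steers)
  then obtain T where T: "\<And>e. T e > a" "\<And>e. steers A B a (T e) 0 e"
    by metis
  define b where "b = Max (T ` (Basis :: (real^'n) set))"
  have le: "T e \<le> b" if "e \<in> Basis" for e
    using that by (simp add: b_def)
  have basis: "steers A B a b 0 e" if "e \<in> Basis" for e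
  proof (rule steers_delay)
    \<comment> \<open>Time invariance lets the transfer to \<open>e\<close> end exactly at
      \<open>b\<close>; resting at the origin fills the time before it.\<close>
    show "steers A B (a + (b - T e)) b 0 e"
      using steers_shift[OF T(2), of "b - T e" e] by simp
  qed (use T(1)[of e] le[OF that] in auto)
  then have "Basis \<subseteq> {xf. steers A B a b 0 xf}"
    by auto
  \<comment> \<open>With both times fixed, the states reachable from the origin form a subspace, so
    reaching the basis vectors suffices.\<close>
  moreover have "subspace {xf. steers A B a b 0 xf}"
  proof (rule subspaceI)
    obtain e :: "real^'n" where "e \<in> Basis"
      using nonempty_Basis by blast
    from steers_scaleR[OF basis[OF this], of 0] show "0 \<in> {xf. steers A B a b 0 xf}"
      by simp
    show "x + y \<in> {xf. steers A B a b 0 xf}"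
      if "x \<in> {xf. steers A B a b 0 xf}" "y \<in> {xf. steers A B a b 0 xf}" for x y
      using steers_add[of A B a b 0 x 0 y] that by simp
    show "c *\<^sub>R x \<in> {xf. steers A B a b 0 xf}" if "x \<in> {xf. steers A B a b 0 xf}" for c x
      using steers_scaleR[of A B a b 0 x c] that by simp
  qed
  ultimately have "span Basis \<subseteq> {xf. steers A B a b 0 xf}"
    by (rule span_minimal)
  then have "steers A B a b 0 xf" for xf
    by (auto simp: span_Basis)
  moreover have "b > a"
    using T(1) le nonempty_Basis less_le_trans by blast
  ultimately show thesis
    using that by blast
qed

section \<open>Target controllability in decomposed coordinates\<close>

lemma sum_UNIV_Plus:
  fixes f :: "'a::finite + 'b::finite \<Rightarrow> 'c::comm_monoid_add"
  shows "(\<Sum>i\<in>UNIV. f i) = (\<Sum>a\<in>UNIV. f (Inl a)) + (\<Sum>b\<in>UNIV. f (Inr b))"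
  using sum.Plus[of UNIV UNIV f] by simp

text \<open>For the matrix \<open>P\<close> of a decomposition, \<open>lower_block P *v x\<close> is
  the uncontrollable component of the state \<open>x\<close>.\<close>

definition lower_block :: "real^'n^('k::finite + 'c::finite) \<Rightarrow> real^'n^'c" where
  "lower_block M = (\<chi> i j. M $ Inr i $ j)"

definition upper_block :: "real^'n^('k::finite + 'c::finite) \<Rightarrow> real^'n^'k" where
  "upper_block M = (\<chi> i j. M $ Inl i $ j)"

text \<open>In the product with \<open>M\<close>, the right columns meet only the vanishing lower
  coordinates of \<open>N *v x\<close>. If \<open>M\<close> inverts \<open>N\<close>, this recovers
  \<open>x\<close> from its upper coordinates alone.\<close>

lemma left_block_upper_block:
  fixes M :: "real^('k::finite + 'c::finite)^'n"
  assumes "lower_block N *v x = 0"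
  shows "left_block M *v (upper_block N *v x) = M *v (N *v x)"
proof -
  have "(N *v x) $ Inr i = 0" for i
    using arg_cong[OF assms, of "\<lambda>v. v $ i"] by (simp add: lower_block_def matrix_vector_mult_def)
  then show ?thesis
    by (simp add: matrix_vector_mult_def left_block_def upper_block_def vec_eq_iff sum_UNIV_Plus)
qed

text \<open>This is the upper left block of \<open>N ** M = mat 1\<close>. It provides the left
  inverse of the left block of \<open>matrix_inv P\<close>.\<close>

lemma upper_block_left_block:
  fixes M :: "real^('k::finite + 'c::finite)^'n"
  assumes "N ** M = mat 1"
  shows "upper_block N ** left_block M = mat 1"
proof -
  have "(\<Sum>k\<in>UNIV. N $ Inl i $ k * M $ k $ Inl j) = (if i = j then 1 else 0)" for i j
    using arg_cong[OF assms, of "\<lambda>X. X $ Inl i $ Inl j"] by (simp add: matrix_matrix_mult_def mat_def)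
  then show ?thesis
    by (simp add: matrix_matrix_mult_def upper_block_def left_block_def mat_def vec_eq_iff)
qed

text \<open>The similarity is rewritten as two intertwining relations, \<open>RM\<close> and
  \<open>MP\<close>. Because of the zero block, the left columns of the first and the lower rows of
  the second each involve a single diagonal block.\<close>

lemma controllability_decomposition_blocks:
  fixes A :: "real^'n^'n" and P :: "real^'n^('k::finite + 'c::finite)"
  assumes "controllability_decomposition A B P Ac A12 Ad Bc"
  shows "P ** matrix_inv P = mat 1" "matrix_inv P ** P = mat 1"
    and "left_block (matrix_inv P) ** Ac = A ** left_block (matrix_inv P)"
    and "left_block (matrix_inv P) ** Bc = B"
    and "lower_block P ** A = Ad ** lower_block P"
    and "lower_block P ** B = 0"
proof -
  let ?R = "matrix_inv P" and ?M = "block_mat Ac A12 0 Ad"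
  have "invertible P" and M: "P ** A ** ?R = ?M" and PB: "P ** B = block_col Bc 0"
    using assms by (auto simp: controllability_decomposition_def)
  then have inv: "P ** ?R = mat 1" "?R ** P = mat 1"
    using someI_ex[of "\<lambda>R. P ** R = mat 1 \<and> R ** P = mat 1"]
    by (auto simp: invertible_def matrix_inv_def)
  show "P ** ?R = mat 1" "?R ** P = mat 1"
    by (fact inv)+
  have "?R ** ?M = ?R ** P ** (A ** ?R)"
    by (simp add: M[symmetric] matrix_mul_assoc)
  then have RM: "?R ** ?M = A ** ?R"
    by (simp add: inv)
  have "?M ** P = P ** A ** (?R ** P)"
    by (simp add: M[symmetric] matrix_mul_assoc)
  then have MP: "?M ** P = P ** A"
    by (simp add: inv)
  have "?R ** block_col Bc 0 = ?R ** P ** B"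
    by (simp add: PB[symmetric] matrix_mul_assoc)
  then have RB: "?R ** block_col Bc 0 = B"
    by (simp add: inv)
  show "left_block ?R ** Ac = A ** left_block ?R"
    unfolding vec_eq_iff
  proof (intro allI)
    fix i j
    show "(left_block ?R ** Ac) $ i $ j = (A ** left_block ?R) $ i $ j"
      using arg_cong[OF RM, of "\<lambda>X. X $ i $ Inl j"]
      by (simp add: matrix_matrix_mult_def left_block_def block_mat_def sum_UNIV_Plus)
  qed
  show "left_block ?R ** Bc = B"
    using RB unfolding vec_eq_iff
    by (simp add: matrix_matrix_mult_def left_block_def block_col_def sum_UNIV_Plus)
  show "lower_block P ** A = Ad ** lower_block P"
    unfolding vec_eq_iff
  proof (intro allI)
    fix i j
    show "(lower_block P ** A) $ i $ j = (Ad ** lower_block P) $ i $ j"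
      using arg_cong[OF MP, of "\<lambda>X. X $ Inr i $ j"]
      by (simp add: matrix_matrix_mult_def lower_block_def block_mat_def block_col_def sum_UNIV_Plus)
  qed
  show "lower_block P ** B = 0"
    unfolding vec_eq_iff
  proof (intro allI)
    fix i j
    show "(lower_block P ** B) $ i $ j = (0) $ i $ j"
      using arg_cong[OF PB, of "\<lambda>X. X $ Inr i $ j"]
      by (simp add: matrix_matrix_mult_def lower_block_def block_mat_def block_col_def sum_UNIV_Plus)
  qed
qed

lemma target_controllable_iff_surj:
  fixes A :: "real^'n^'n" and P :: "real^'n^('k::finite + 'c::finite)"
  assumes "controllability_decomposition A B P Ac A12 Ad Bc"
  shows "target_controllable A B H \<longleftrightarrow> surj ((*v) (H ** left_block (matrix_inv P)))"
proof -
  let ?R = "matrix_inv P"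
  note blocks = controllability_decomposition_blocks[OF assms]
  show ?thesis
  proof
    assume tc: "target_controllable A B H"
    show "surj ((*v) (H ** left_block ?R))"
      unfolding surj_def
    proof
      fix yf
      \<comment> \<open>Starting at the origin makes the uncontrollable component zero at all times,
        in particular at the end.\<close>
      obtain t xf where t: "t > 0" "steers A B 0 t 0 xf" "H *v xf = yf"
        using tc unfolding target_controllable_steers by blast
      have "lower_block P *v xf = 0"
        using steers_uncontrolled_zero[of Ad 0 t] steers_intertwine[OF t(2) blocks(5,6)] t(1) by simp
      from left_block_upper_block[OF this, of ?R]
      have "left_block ?R *v (upper_block P *v xf) = xf"
        by (simp add: matrix_vector_mul_assoc blocks)
      then have "yf = (H ** left_block ?R) *v (upper_block P *v xf)"
        using t(3) by (simp add: matrix_vector_mul_assoc[symmetric])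
      then show "\<exists>z. yf = (H ** left_block ?R) *v z" ..
    qed
  next
    assume surj: "surj ((*v) (H ** left_block ?R))"
    show "target_controllable A B H"
      unfolding target_controllable_steers
    proof (intro allI)
      fix t0 x0 yf
      have "controllable Ac Bc"
        using assms by (simp add: controllability_decomposition_def)
      \<comment> \<open>The terminal time must be fixed first: the free endpoint \<open>x\<close>,
        and with it the correction \<open>z\<close>, depends on \<open>tf\<close>.\<close>
      then obtain tf where tf: "tf > t0" "\<And>zf. steers Ac Bc t0 tf 0 zf"
        using controllable_fixed_time by blast
      obtain x where x: "steers A B t0 tf x0 x"
        using steers_free .
      \<comment> \<open>The vector \<open>z\<close> is a controllable state whose output makes up
        the difference between \<open>yf\<close> and the output of the free motion.\<close>
      obtain z where z: "yf - H *v x = (H ** left_block ?R) *v z"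
        using surj by (metis surjD)
      have "steers A B t0 tf (x0 + left_block ?R *v 0) (x + left_block ?R *v z)"
        by (intro steers_add x steers_intertwine[OF tf(2)] blocks)
      moreover have "H *v (x + left_block ?R *v z) = yf"
        using z by (simp add: matrix_vector_right_distrib matrix_vector_mul_assoc algebra_simps)
      ultimately show "\<exists>tf>t0. \<exists>xf. steers A B t0 tf x0 xf \<and> H *v xf = yf"
        using tf(1) by auto
    qed
  qed
qed

section \<open>Independent rows\<close>

lemma independent_rows_subset:
  assumes "independent_rows M J" "I \<subseteq> J"
  shows "independent_rows M I"
  using assms unfolding independent_rows_def
  by (meson image_mono independent_mono inj_on_subset)

text \<open>Surjectivity means full row rank. The dimension of the row span is at most the number of
  distinct rows, which is at most the number of labels; equality throughout forces independence and
  injectivity together.\<close>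

lemma surj_iff_independent_rows:
  fixes M :: "real^'k^'p"
  shows "surj ((*v) M) \<longleftrightarrow> independent_rows M UNIV"
proof -
  have rank: "rank M = dim (range (\<lambda>i. row i M))"
    by (simp add: row_rank_def rows_def full_SetCompr_eq)
  have "surj ((*v) M) \<longleftrightarrow> rank M = CARD('p)"
    using full_rank_surjective[of M] by simp
  also have "\<dots> \<longleftrightarrow> independent_rows M UNIV"
  proof
    assume *: "rank M = CARD('p)"
    have "dim (range (\<lambda>i. row i M)) \<le> card (range (\<lambda>i. row i M))"
      by (simp add: dim_le_card')
    moreover have "card (range (\<lambda>i. row i M)) \<le> CARD('p)"
      by (rule card_image_le) simp
    ultimately have card: "card (range (\<lambda>i. row i M)) = CARD('p)"
      "dim (range (\<lambda>i. row i M)) = card (range (\<lambda>i. row i M))"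
      using * rank by auto
    then show "independent_rows M UNIV"
      unfolding independent_rows_def
      using eq_card_imp_inj_on[of UNIV "\<lambda>i. row i M"]
        card_le_dim_spanning[of "range (\<lambda>i. row i M)" "span (range (\<lambda>i. row i M))"]
      by (simp add: span_superset)
  next
    assume "independent_rows M UNIV"
    then show "rank M = CARD('p)"
      unfolding independent_rows_def rank by (simp add: dim_eq_card_independent card_image)
  qed
  finally show ?thesis .
qed

lemma row_target_matrix_mult: "row i (target_matrix vt ** M) = row (vt i) M"
  by (simp add: row_def target_matrix_def matrix_matrix_mult_def axis_def vec_eq_iff if_distribR
      sum.delta if_distrib[of "\<lambda>x. x * _"] cong: if_cong)

text \<open>Multiplying by the target matrix selects rows, and \<open>inj vt\<close> ensures that no
  row label is selected twice.\<close>

lemma independent_rows_target: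
  assumes "inj vt"
  shows "independent_rows (target_matrix vt ** M) UNIV \<longleftrightarrow> independent_rows M (range vt)"
  using assms comp_inj_on_iff[of vt UNIV "\<lambda>i. row i M"]
  by (simp add: independent_rows_def row_target_matrix_mult image_image o_def)

section \<open>Maximal independent groups of rows\<close>

lemma maximal_independent_rows_extend:
  fixes M :: "real^'k^'n"
  assumes "independent_rows M I"
  obtains J where "I \<subseteq> J" "maximal_independent_rows M J"
proof -
  obtain J where J: "I \<subseteq> J" "independent_rows M J"
    and max: "\<And>K. independent_rows M K \<Longrightarrow> J \<subseteq> K \<Longrightarrow> K = J"
    using finite_has_maximal2[of "Collect (independent_rows M)" I] assms by auto
  have "maximal_independent_rows M J"
    unfolding maximal_independent_rows_def
  proof (intro conjI J allI impI notI)
    fix K assume "J \<subset> K" "independent_rows M K"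
    then show False
      using max[of K] by auto
  qed
  with J(1) show thesis
    by (rule that)
qed

text \<open>By maximality every row lies in the span of the chosen ones, and the left inverse
  \<open>N\<close> makes the rows span the whole space. The chosen rows therefore form a
  basis.\<close>

lemma card_maximal_independent_rows:
  fixes M :: "real^'k^'n"
  assumes "N ** M = mat 1" "maximal_independent_rows M J"
  shows "card J = CARD('k)"
proof -
  let ?r = "\<lambda>i. row i M"
  have ind: "inj_on ?r J" "independent (?r ` J)"
    using assms(2) by (auto simp: maximal_independent_rows_def independent_rows_def)
  have "?r i \<in> span (?r ` J)" for i
  proof (rule ccontr)
    assume i: "?r i \<notin> span (?r ` J)"
    \<comment> \<open>A row outside the span differs from every chosen row. This gives both
      injectivity on \<open>insert i J\<close> and the strictness of the extension.\<close>
    then have "?r i \<notin> ?r ` J"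
      by (metis span_base)
    with i ind have "independent_rows M (insert i J)"
      by (auto simp: independent_rows_def independent_insertI)
    moreover have "J \<subset> insert i J"
      using \<open>?r i \<notin> ?r ` J\<close> by blast
    ultimately show False
      using assms(2) by (auto simp: maximal_independent_rows_def)
  qed
  then have "rows M \<subseteq> span (?r ` J)"
    by (auto simp: rows_def)
  moreover have "span (rows M) = UNIV"
    using assms(1) matrix_left_invertible_span_rows by blast
  ultimately have "span (?r ` J) = UNIV"
    by (metis span_mono span_span top.extremum_uniqueI)
  then have "CARD('k) = dim (?r ` J)"
    by (metis dim_UNIV dim_span DIM_cart DIM_real mult.right_neutral)
  also have "\<dots> = card J"
    using ind by (simp add: dim_eq_card_independent card_image)
  finally show ?thesis ..
qed

theorem theorem2:
  fixes E :: "('n::finite \<times> 'n) set" and w :: "'n \<times> 'n \<Rightarrow> real"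
    and vl :: "'l::finite \<Rightarrow> 'n" and vt :: "'p::finite \<Rightarrow> 'n"
    and P :: "real^'n^('k::finite + 'c::finite)"
    and Lc :: "real^'k^'k" and L12 :: "real^'c^'k" and Lu :: "real^'c^'c" and Bc :: "real^'l^'k"
  assumes "irrefl E" and "inj vl" and "inj vt"
    and "\<not> controllable (- laplacian E w) (leader_matrix vl)"
    and "controllability_decomposition (- laplacian E w) (leader_matrix vl) P Lc L12 Lu Bc"
  shows "target_controllable (- laplacian E w) (leader_matrix vl) (target_matrix vt) \<longleftrightarrow>
    (\<exists>\<gamma> :: 'k \<Rightarrow> 'n. inj \<gamma> \<and>
       maximal_independent_rows (left_block (matrix_inv P)) (range \<gamma>) \<and>
       range vt \<subseteq> range \<gamma>)"
proof -
  let ?P1 = "left_block (matrix_inv P)"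
  have "target_controllable (- laplacian E w) (leader_matrix vl) (target_matrix vt) \<longleftrightarrow>
      independent_rows ?P1 (range vt)"
    by (simp add: target_controllable_iff_surj[OF assms(5)] surj_iff_independent_rows
        independent_rows_target[OF assms(3)])
  also have "\<dots> \<longleftrightarrow> (\<exists>\<gamma> :: 'k \<Rightarrow> 'n. inj \<gamma> \<and>
      maximal_independent_rows ?P1 (range \<gamma>) \<and> range vt \<subseteq> range \<gamma>)" (is "_ \<longleftrightarrow> ?rhs")
  proof
    assume "independent_rows ?P1 (range vt)"
    then obtain J where J: "range vt \<subseteq> J" "maximal_independent_rows ?P1 J"
      using maximal_independent_rows_extend by blast
    have "card J = CARD('k)"
      \<comment> \<open>The left inverse required here is \<open>upper_block P\<close>.\<close>
      using card_maximal_independent_rows[OF upper_block_left_block J(2)]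
        controllability_decomposition_blocks(1)[OF assms(5)] by blast
    \<comment> \<open>Since \<open>J\<close> has as many elements as the type \<open>'k\<close>, its
      labels can be enumerated by that type.\<close>
    then obtain \<gamma> :: "'k \<Rightarrow> 'n" where "bij_betw \<gamma> UNIV J"
      using finite_same_card_bij[of "UNIV :: 'k set" J] by auto
    then show ?rhs
      using J by (auto simp: bij_betw_def)
  next
    assume ?rhs
    then show "independent_rows ?P1 (range vt)"
      using independent_rows_subset by (auto simp: maximal_independent_rows_def)
  qed
  finally show ?thesis .
qed

end
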